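(* Let $\{\phi_i(x)=\rho_ix+a_i\}_{i=1}^\ell$ be an iterated function system in $\mathbb{R}^d$ with attractor $E$, where $0<\rho_i<1$ and $a_i\in\mathbb{R}^d$ for $1\leq i\leq\ell$. Let $F$ be the set of the fixed points of the maps $\phi_1,\ldots,\phi_\ell$. Then for every integer $n\geq 1+\ell/(\min_{1\le i\le\ell}\rho_i)$, $$\oplus_nE=n\,\mathrm{conv}(F).$$
   Context: Here each $\rho_i$ is a scalar. The attractor $E$ is the unique non-empty compact set with $E=\bigcup_{i=1}^\ell\phi_i(E)$. $\oplus_nE=\{x_1+\cdots+x_n: x_i\in E,\ 1\le i\le n\}$, $\mathrm{conv}(F)$ is the convex hull of $F$, and $n\,\mathrm{conv}(F)=\{nx: x\in\mathrm{conv}(F)\}$. *)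

theory Defs
  imports "HOL-Analysis.Analysis"
begin

definition hom_map :: "(nat \<Rightarrow> real) \<Rightarrow> (nat \<Rightarrow> 'v::real_vector) \<Rightarrow> nat \<Rightarrow> 'v \<Rightarrow> 'v" where
  "hom_map \<rho> a i x = \<rho> i *\<^sub>R x + a i"

text \<open>Uniqueness of the attractor is not part of the predicate: for a finite nonempty family of
  contractions of a complete space it is a consequence of the three conditions below.\<close>

definition is_attractor :: "nat \<Rightarrow> (nat \<Rightarrow> 'v \<Rightarrow> 'v) \<Rightarrow> 'v::topological_space set \<Rightarrow> bool" where
  "is_attractor l \<phi> E \<longleftrightarrow> E \<noteq> {} \<and> compact E \<and> E = (\<Union>i\<in>{1..l}. \<phi> i ` E)"

definition fixed_points :: "nat \<Rightarrow> (nat \<Rightarrow> 'v \<Rightarrow> 'v) \<Rightarrow> 'v set" where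
  "fixed_points l \<phi> = {x. \<exists>i\<in>{1..l}. \<phi> i x = x}"

definition nfold_sum :: "nat \<Rightarrow> 'v::comm_monoid_add set \<Rightarrow> 'v set" where
  "nfold_sum n E = {\<Sum>i\<in>{1..n}. x i | x. \<forall>i\<in>{1..n}. x i \<in> E}"

end

theory Submission
  imports Defs
begin

text \<open>Let \<open>C\<close> be the convex hull of \<open>F\<close>. A point of \<open>n C\<close> is kept in a sum \<open>\<Sum>j. (r j C + b j)\<close> of
  \<open>n\<close> small copies of \<open>C\<close>, where each similarity \<open>y \<mapsto> r j y + b j\<close> maps \<open>E\<close> into itself. The largest
  copy \<open>r k C + b k\<close> is repeatedly replaced by its image under one of the maps of the system. Doing
  so keeps all \<open>r j\<close> within a factor \<open>min \<rho>\<close> of each other, so that \<open>n \<ge> 1 + l / min \<rho>\<close> gives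
  \<open>r k \<le> (\<Sum>j. r j) / l\<close>. Hence some fixed point has a weight at least \<open>r k\<close> in the convex
  representation of the point, and the map with this fixed point is a possible choice. The total
  size \<open>\<Sum>j. r j\<close> decays geometrically, and the compact set of \<open>n\<close>-fold sums of \<open>E\<close> contains points
  at a distance comparable to it.\<close>

lemma sum_fun_upd:
  fixes g :: "'b \<Rightarrow> 'c::ab_group_add"
  assumes "finite A" "k \<in> A"
  shows "sum (g(k := v)) A = sum g A + (v - g k)"
  using assms by (simp add: sum.remove[of A k])

lemma exists_average_le:
  fixes t :: "'b \<Rightarrow> real"
  assumes "finite A" "A \<noteq> {}"
  shows "\<exists>x\<in>A. sum t A \<le> real (card A) * t x"
proof (rule ccontr)
  assume "\<not> ?thesis"
  then have *: "\<And>x. x \<in> A \<Longrightarrow> card A * t x < sum t A" by force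
  have "(\<Sum>x\<in>A. card A * t x) < (\<Sum>x\<in>A. sum t A)"
    using assms * by (intro sum_strict_mono) auto
  then show False by (simp add: sum_distrib_left)
qed

section \<open>n-fold sums: recursion, compactness, convex bound\<close>

lemma nfold_sum_0: "nfold_sum 0 E = {0}"
  by (auto simp: nfold_sum_def)

lemma nfold_sum_Suc: "nfold_sum (Suc n) E = {x + y | x y. x \<in> nfold_sum n E \<and> y \<in> E}"
proof (intro equalityI subsetI)
  fix z assume "z \<in> nfold_sum (Suc n) E"
  then obtain x where "z = (\<Sum>i\<in>{1..n}. x i) + x (Suc n)" "\<forall>i\<in>{1..Suc n}. x i \<in> E"
    unfolding nfold_sum_def by auto
  moreover from this have "(\<Sum>i\<in>{1..n}. x i) \<in> nfold_sum n E"
    unfolding nfold_sum_def by auto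
  ultimately show "z \<in> {x + y | x y. x \<in> nfold_sum n E \<and> y \<in> E}" by force
next
  fix z assume "z \<in> {x + y | x y. x \<in> nfold_sum n E \<and> y \<in> E}"
  then obtain x y where z: "z = (\<Sum>i\<in>{1..n}. x i) + y" "\<forall>i\<in>{1..n}. x i \<in> E" "y \<in> E"
    unfolding nfold_sum_def by auto
  have "(\<Sum>i\<in>{1..n}. x i) = (\<Sum>i\<in>{1..n}. (x(Suc n := y)) i)"
    by (intro sum.cong) auto
  then have "z = (\<Sum>i\<in>{1..Suc n}. (x(Suc n := y)) i)"
    using z by simp
  then show "z \<in> nfold_sum (Suc n) E"
    using z unfolding nfold_sum_def by (intro CollectI exI[of _ "x(Suc n := y)"]) auto
qed

lemma compact_nfold_sum:
  fixes E :: "'v::real_normed_vector set"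
  assumes "compact E"
  shows "compact (nfold_sum n E)"
  by (induction n) (simp_all only: nfold_sum_0 nfold_sum_Suc compact_sums assms finite_imp_compact
      finite.emptyI finite.insertI)

lemma nfold_sum_subset_convex:
  assumes "convex C" "E \<subseteq> C" "n \<ge> 1"
  shows "nfold_sum n E \<subseteq> (\<lambda>x. real n *\<^sub>R x) ` C"
proof
  fix z assume "z \<in> nfold_sum n E"
  then obtain x where x: "z = (\<Sum>i\<in>{1..n}. x i)" "\<forall>i\<in>{1..n}. x i \<in> E"
    unfolding nfold_sum_def by auto
  have "(\<Sum>i\<in>{1..n}. (1 / real n) *\<^sub>R x i) \<in> C"
    using assms x by (intro convex_sum) auto
  then have "(1 / real n) *\<^sub>R z \<in> C"
    by (simp add: x scaleR_sum_right)
  moreover have "z = real n *\<^sub>R ((1 / real n) *\<^sub>R z)"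
    using assms by simp
  ultimately show "z \<in> (\<lambda>x. real n *\<^sub>R x) ` C" by blast
qed

section \<open>Sums of shrinking copies of the convex hull\<close>

text \<open>For convex \<open>C\<close>, the Minkowski sum of the sets \<open>r j C\<close> is
  \<open>(\<Sum>j. r j) C\<close>. So one weight function \<open>t\<close> of total mass
  \<open>sum r {1..n}\<close> records that \<open>x\<close> lies in the sum of all \<open>n\<close>
  copies; no point has to be chosen in each copy.\<close>

definition similar_cover ::
  "nat \<Rightarrow> real \<Rightarrow> 'v::real_vector set \<Rightarrow> 'v set \<Rightarrow> 'v \<Rightarrow> (nat \<Rightarrow> real) \<Rightarrow> (nat \<Rightarrow> 'v) \<Rightarrow> ('v \<Rightarrow> real) \<Rightarrow> bool"
  where
  "similar_cover n m E F x r b t \<longleftrightarrow>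
    (\<forall>j\<in>{1..n}. 0 < r j \<and> (\<forall>y\<in>E. r j *\<^sub>R y + b j \<in> E)) \<and>
    (\<forall>j\<in>{1..n}. \<forall>k\<in>{1..n}. m * r k \<le> r j) \<and>
    (\<forall>f\<in>F. 0 \<le> t f) \<and> sum t F = sum r {1..n} \<and>
    x = sum b {1..n} + (\<Sum>f\<in>F. t f *\<^sub>R f)"

text \<open>Shrinking copy \<open>k\<close> towards the image of \<open>f\<close> turns a part
  \<open>s *\<^sub>R f\<close> of the weighted sum into translation. This is legitimate as soon as
  \<open>t f\<close> can afford to lose the mass \<open>s\<close>.\<close>

lemma similar_cover_step:
  assumes cover: "similar_cover n m E F x r b t"
    and F: "finite F" "F \<noteq> {}"
    and n: "n \<ge> 1" "card F \<le> (real n - 1) * m"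
    and m: "0 < m"
    and c: "\<And>f. f \<in> F \<Longrightarrow> m \<le> c f \<and> c f \<le> q \<and> (\<forall>y\<in>E. c f *\<^sub>R y + (1 - c f) *\<^sub>R f \<in> E)"
    and q: "q < 1"
  shows "\<exists>r' b' t'. similar_cover n m E F x r' b' t' \<and>
    sum r' {1..n} \<le> (1 - (1 - q) / n) * sum r {1..n}"
proof -
  let ?R = "sum r {1..n}"
  have r: "\<And>j. j \<in> {1..n} \<Longrightarrow> 0 < r j" and E: "\<And>j y. j \<in> {1..n} \<Longrightarrow> y \<in> E \<Longrightarrow> r j *\<^sub>R y + b j \<in> E"
    and comp: "\<And>j k. j \<in> {1..n} \<Longrightarrow> k \<in> {1..n} \<Longrightarrow> m * r k \<le> r j"
    and t: "\<And>f. f \<in> F \<Longrightarrow> 0 \<le> t f" "sum t F = ?R"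
    and x: "x = sum b {1..n} + (\<Sum>f\<in>F. t f *\<^sub>R f)"
    using cover unfolding similar_cover_def by blast+
  have "Max (r ` {1..n}) \<in> r ` {1..n}" using n by (intro Max_in) auto
  then obtain k where k: "k \<in> {1..n}" "r k = Max (r ` {1..n})" by (metis imageE)
  have max: "r j \<le> r k" if "j \<in> {1..n}" for j using that unfolding k(2) by (intro Max_ge) auto
  have "?R \<le> real n * r k" using sum_bounded_above[of "{1..n}" r "r k"] max by simp
  then have average: "?R / n \<le> r k" using n by (simp add: field_simps)
  \<comment> \<open>Only the other \<open>n - 1\<close> copies are counted, each of size at least
    \<open>m * r k\<close>; hence the summand 1 in the bound on \<open>n\<close>.\<close>
  have "real (card ({1..n} - {k})) * (m * r k) \<le> sum r ({1..n} - {k})"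
    using comp k(1) by (intro sum_bounded_below) auto
  then have "(real n - 1) * m * r k \<le> sum r ({1..n} - {k})"
    using k n by (simp add: of_nat_diff mult_ac)
  also have "\<dots> \<le> ?R" using k r[OF k(1)] by (simp add: sum.remove[of _ k])
  finally have "(real n - 1) * m * r k \<le> ?R" .
  moreover have "card F * r k \<le> (real n - 1) * m * r k"
    using n r[OF k(1)] by (intro mult_right_mono) auto
  ultimately have "card F * r k \<le> sum t F" using t by linarith
  moreover obtain f where f: "f \<in> F" "sum t F \<le> card F * t f" using exists_average_le[OF F] by blast
  ultimately have "card F * r k \<le> card F * t f" by linarith
  moreover have "0 < real (card F)" using F by (simp add: card_gt_0_iff)
  ultimately have weight: "r k \<le> t f" by (simp only: mult_le_cancel_left_pos)
  \<comment> \<open>The size lost by copy \<open>k\<close>, which is also the mass moved from the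
    weight of \<open>f\<close> into \<open>b k\<close>.\<close>
  define s where "s = r k * (1 - c f)"
  have cf: "0 < c f" "c f < 1" "c f \<le> q" "m \<le> c f" using c[OF f(1)] m q by auto
  have "s \<le> r k * 1" unfolding s_def using r[OF k(1)] cf by (intro mult_left_mono) auto
  then have s: "s \<le> t f" using weight by simp
  let ?r = "r(k := r k * c f)" and ?b = "b(k := b k + s *\<^sub>R f)" and ?t = "t(f := t f - s)"
  have sum_r: "sum ?r {1..n} = ?R - s"
    using k by (subst sum_fun_upd) (auto simp: s_def algebra_simps)
  have sum_t: "sum ?t F = ?R - s" using f F t by (subst sum_fun_upd) auto
  have sum_b: "sum ?b {1..n} = sum b {1..n} + s *\<^sub>R f" using k by (subst sum_fun_upd) auto
  have "(\<Sum>g\<in>F. ?t g *\<^sub>R g) = (\<Sum>g\<in>F. ((\<lambda>g. t g *\<^sub>R g)(f := (t f - s) *\<^sub>R f)) g)"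
    by (intro sum.cong) auto
  also have "\<dots> = (\<Sum>g\<in>F. t g *\<^sub>R g) - s *\<^sub>R f"
    using f F by (subst sum_fun_upd) (auto simp: algebra_simps)
  finally have sum_x: "x = sum ?b {1..n} + (\<Sum>g\<in>F. ?t g *\<^sub>R g)" using x sum_b by simp
  have maps: "?r j *\<^sub>R y + ?b j \<in> E" if j: "j \<in> {1..n}" and y: "y \<in> E" for j y
  proof (cases "j = k")
    case True
    \<comment> \<open>The new map is the old one precomposed with the homothety centred at
      \<open>f\<close>, so it still sends \<open>E\<close> into \<open>E\<close>.\<close>
    have "r k *\<^sub>R (c f *\<^sub>R y + (1 - c f) *\<^sub>R f) + b k \<in> E"
      using c[OF f(1)] y by (intro E[OF k(1)]) auto
    also have "r k *\<^sub>R (c f *\<^sub>R y + (1 - c f) *\<^sub>R f) + b k = ?r j *\<^sub>R y + ?b j"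
      using True by (simp add: s_def algebra_simps)
    finally show ?thesis .
  qed (use E j y in auto)
  have le: "?r j \<le> r j" if "j \<in> {1..n}" for j
    using r[OF k(1)] cf by simp
  have "m * ?r i \<le> ?r j" if ij: "i \<in> {1..n}" "j \<in> {1..n}" for i j
  proof (cases "j = k")
    case True
    \<comment> \<open>Only the shrunken copy can violate the size comparison. It does not, since
      \<open>r k\<close> was maximal and shrank by a factor of at least \<open>m\<close>.\<close>
    have "m * ?r i \<le> m * r k" using le[OF ij(1)] max[OF ij(1)] m by (intro mult_left_mono) linarith+
    also have "\<dots> \<le> c f * r k" using cf r[OF k(1)] by (intro mult_right_mono) auto
    finally show ?thesis using True by (simp add: mult.commute)
  next
    case False
    have "m * ?r i \<le> m * r i" using le[OF ij(1)] m by (intro mult_left_mono) linarith+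
    then show ?thesis using comp[OF ij(2,1)] False by simp
  qed
  moreover have "0 < ?r j" if "j \<in> {1..n}" for j using r[OF that] r[OF k(1)] cf by simp
  moreover have "0 \<le> ?t g" if "g \<in> F" for g using t(1)[OF that] s by simp
  ultimately have "similar_cover n m E F x ?r ?b ?t"
    unfolding similar_cover_def sum_r sum_t using maps sum_x by blast
  \<comment> \<open>The largest copy has at least average size, so a fixed fraction of the total is
    lost.\<close>
  moreover have "(?R / n) * (1 - q) \<le> s"
    unfolding s_def using average cf q r[OF k(1)] by (intro mult_mono) auto
  then have "sum ?r {1..n} \<le> (1 - (1 - q) / n) * ?R"
    unfolding sum_r by (simp add: algebra_simps)
  ultimately show ?thesis by blast
qed

text \<open>Putting the same point \<open>e\<close> into every copy gives an n-fold sum with the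
  same translation part as \<open>x\<close>. The difference is
  \<open>\<Sum>f\<in>F. t f *\<^sub>R (f - e)\<close>, and the total mass of \<open>t\<close> is
  \<open>sum r {1..n}\<close>.\<close>

lemma similar_cover_nfold_sum_approx:
  fixes E :: "'v::real_normed_vector set"
  assumes cover: "similar_cover n m E F x r b t" and "finite F" and e: "e \<in> E"
    and D: "\<And>f. f \<in> F \<Longrightarrow> norm (f - e) \<le> D"
  shows "\<exists>y\<in>nfold_sum n E. dist y x \<le> sum r {1..n} * D"
proof -
  have E: "\<And>j y. j \<in> {1..n} \<Longrightarrow> y \<in> E \<Longrightarrow> r j *\<^sub>R y + b j \<in> E"
    and t: "\<And>f. f \<in> F \<Longrightarrow> 0 \<le> t f" "sum t F = sum r {1..n}"
    and x: "x = sum b {1..n} + (\<Sum>f\<in>F. t f *\<^sub>R f)"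
    using cover unfolding similar_cover_def by blast+
  let ?y = "\<Sum>j\<in>{1..n}. r j *\<^sub>R e + b j"
  have y: "?y \<in> nfold_sum n E"
    unfolding nfold_sum_def using E e by (intro CollectI exI[of _ "\<lambda>j. r j *\<^sub>R e + b j"]) auto
  have "?y = sum b {1..n} + sum t F *\<^sub>R e"
    unfolding t(2) by (simp add: sum.distrib scaleR_sum_left)
  then have "x - ?y = (\<Sum>f\<in>F. t f *\<^sub>R (f - e))"
    unfolding x by (simp add: scaleR_sum_left sum_subtractf algebra_simps)
  then have "dist ?y x = norm (\<Sum>f\<in>F. t f *\<^sub>R (f - e))"
    by (metis dist_commute dist_norm)
  also have "\<dots> \<le> (\<Sum>f\<in>F. t f * D)"
    using t D by (intro sum_norm_le) (simp add: mult_left_mono)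
  also have "\<dots> = sum r {1..n} * D" by (simp add: sum_distrib_right[symmetric] t)
  finally have "dist ?y x \<le> sum r {1..n} * D" .
  then show ?thesis using y by blast
qed

lemma scaled_convex_hull_subset_nfold_sum:
  fixes E :: "'v::real_normed_vector set"
  assumes E: "compact E" "E \<noteq> {}"
    and F: "finite F" "F \<noteq> {}"
    and n: "n \<ge> 1" "card F \<le> (real n - 1) * m"
    and m: "0 < m"
    and c: "\<And>f. f \<in> F \<Longrightarrow> m \<le> c f \<and> c f \<le> q \<and> (\<forall>y\<in>E. c f *\<^sub>R y + (1 - c f) *\<^sub>R f \<in> E)"
    and q: "q < 1"
  shows "(\<lambda>x. real n *\<^sub>R x) ` (convex hull F) \<subseteq> nfold_sum n E"
proof (rule image_subsetI)
  fix z assume "z \<in> convex hull F"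
  then obtain u where u: "\<forall>f\<in>F. 0 \<le> u f" "sum u F = 1" "(\<Sum>f\<in>F. u f *\<^sub>R f) = z"
    using F by (auto simp: convex_hull_finite)
  let ?x = "real n *\<^sub>R z" and ?h = "1 - (1 - q) / n"
  obtain f where "f \<in> F" using F by blast
  then have "0 < q" using c[of f] m by linarith
  then have "(1 - q) / n < 1" "0 < (1 - q) / n" using q n by (simp_all add: field_simps)
  then have h: "0 \<le> ?h" "?h < 1" by linarith+
  have m1: "m \<le> 1" using c[OF \<open>f \<in> F\<close>] q by linarith
  have cover: "\<exists>r b t. similar_cover n m E F ?x r b t \<and> sum r {1..n} \<le> ?h ^ N * n" for N
  proof (induction N)
    case 0
    \<comment> \<open>Start with \<open>n\<close> unscaled copies of the hull, that is, with
      identity maps; the barycentric weights of \<open>z\<close> are multiplied by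
      \<open>n\<close>.\<close>
    have "similar_cover n m E F ?x (\<lambda>_. 1) (\<lambda>_. 0) (\<lambda>f. n * u f)"
      unfolding similar_cover_def using u m1
      by (simp add: sum_distrib_left[symmetric] scaleR_sum_right u(3)[symmetric])
    then show ?case by force
  next
    case (Suc N)
    then obtain r b t where rbt: "similar_cover n m E F ?x r b t" "sum r {1..n} \<le> ?h ^ N * n" by blast
    obtain r' b' t' where *: "similar_cover n m E F ?x r' b' t'" "sum r' {1..n} \<le> ?h * sum r {1..n}"
      using similar_cover_step[OF rbt(1) F n m c q] by blast
    have "?h * sum r {1..n} \<le> ?h * (?h ^ N * n)" using rbt h by (intro mult_left_mono) auto
    then have "sum r' {1..n} \<le> ?h ^ Suc N * n" using * by (simp add: mult_ac)
    then show ?case using * by blast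
  qed
  obtain e where e: "e \<in> E" using E by blast
  \<comment> \<open>A sum instead of a maximum: it bounds every distance from \<open>e\<close> to
    \<open>F\<close>, which is all the limit needs.\<close>
  define D where "D = (\<Sum>f\<in>F. norm (f - e))"
  have D: "norm (f - e) \<le> D" if "f \<in> F" for f
    unfolding D_def using that F by (intro member_le_sum) auto
  have "0 \<le> D" unfolding D_def by (intro sum_nonneg) auto
  have "\<exists>y\<in>nfold_sum n E. dist y ?x \<le> ?h ^ N * n * D" for N
  proof -
    obtain r b t where rbt: "similar_cover n m E F ?x r b t" "sum r {1..n} \<le> ?h ^ N * n"
      using cover by blast
    obtain y where y: "y \<in> nfold_sum n E" "dist y ?x \<le> sum r {1..n} * D"
      using similar_cover_nfold_sum_approx[OF rbt(1) F(1) e D] by blast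
    have "sum r {1..n} * D \<le> ?h ^ N * n * D" using rbt(2) \<open>0 \<le> D\<close> by (intro mult_right_mono)
    with y show ?thesis by (intro bexI[of _ y]) linarith+
  qed
  then obtain y where y: "\<And>N. y N \<in> nfold_sum n E" "\<And>N. dist (y N) ?x \<le> ?h ^ N * n * D"
    by metis
  have "(\<lambda>N. ?h ^ N) \<longlonglongrightarrow> 0" using h by (intro LIMSEQ_power_zero) simp
  then have "(\<lambda>N. ?h ^ N * n * D) \<longlonglongrightarrow> 0 * real n * D" by (intro tendsto_mult tendsto_const)
  then have "(\<lambda>N. dist (y N) ?x) \<longlonglongrightarrow> 0"
    using y(2)
    by (intro tendsto_sandwich[of "\<lambda>_. 0" "\<lambda>N. dist (y N) ?x" _ "\<lambda>N. ?h ^ N * n * D"]) auto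
  then have "y \<longlonglongrightarrow> ?x" by (rule tendsto_dist_iff[THEN iffD2])
  moreover have "closed (nfold_sum n E)" using E by (intro compact_imp_closed compact_nfold_sum)
  ultimately show "?x \<in> nfold_sum n E"
    using y(1) closed_sequentially by blast
qed

section \<open>The attractor lies in the convex hull\<close>

text \<open>Take \<open>x\<close> in \<open>E\<close> farthest from \<open>C\<close>. If its
  distance were positive, the point \<open>y\<close> supplied by \<open>step\<close> would be
  strictly farther away.\<close>

lemma compact_subset_closed_of_contraction:
  fixes C :: "'v::metric_space set"
  assumes "compact E" "closed C" "C \<noteq> {}"
    and step: "\<And>x. x \<in> E \<Longrightarrow> \<exists>y\<in>E. \<exists>c<1. infdist x C \<le> c * infdist y C"
  shows "E \<subseteq> C"
proof
  fix z assume z: "z \<in> E"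
  have "continuous_on E (\<lambda>x. infdist x C)" by (intro continuous_intros)
  then obtain x where x: "x \<in> E" "\<And>y. y \<in> E \<Longrightarrow> infdist y C \<le> infdist x C"
    using continuous_attains_sup[OF assms(1), of "\<lambda>x. infdist x C"] z by blast
  obtain y c where yc: "y \<in> E" "c < 1" "infdist x C \<le> c * infdist y C" using step x(1) by blast
  have "infdist x C \<le> 0"
  proof (rule ccontr)
    assume pos: "\<not> infdist x C \<le> 0"
    have "infdist y C > 0"
      using pos yc(3) infdist_nonneg[of y C] by (cases "infdist y C = 0") auto
    then have "c * infdist y C < 1 * infdist y C" using yc(2) by (intro mult_strict_right_mono)
    then show False using x(2)[OF yc(1)] yc(3) by linarith
  qed
  then have "infdist z C = 0" using x(2)[OF z] infdist_nonneg[of z C] by linarith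
  then show "z \<in> C" using assms in_closed_iff_infdist_zero by blast
qed

text \<open>A homothety with centre in \<open>C\<close> and ratio at most 1 maps \<open>C\<close>
  into itself by convexity and multiplies distances by \<open>c\<close>.\<close>

lemma infdist_convex_homothety:
  fixes C :: "'v::real_normed_vector set"
  assumes "convex C" "closed C" "p \<in> C" "0 < c" "c \<le> 1"
  shows "infdist (c *\<^sub>R y + (1 - c) *\<^sub>R p) C \<le> c * infdist y C"
proof -
  \<comment> \<open>Dividing by \<open>c\<close> gives a lower bound for \<open>dist y w\<close>
    uniform in \<open>w\<close>, so it passes to the infimum.\<close>
  have "infdist (c *\<^sub>R y + (1 - c) *\<^sub>R p) C / c \<le> dist y w" if "w \<in> C" for w
  proof -
    have "c *\<^sub>R w + (1 - c) *\<^sub>R p \<in> C" using assms that by (intro convexD) auto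
    then have "infdist (c *\<^sub>R y + (1 - c) *\<^sub>R p) C
        \<le> dist (c *\<^sub>R y + (1 - c) *\<^sub>R p) (c *\<^sub>R w + (1 - c) *\<^sub>R p)"
      by (rule infdist_le)
    also have "\<dots> = c * dist y w"
      using assms by (simp add: dist_norm flip: scaleR_diff_right)
    finally show ?thesis using assms by (simp add: field_simps)
  qed
  moreover have "C \<noteq> {}" using assms by blast
  ultimately have "infdist (c *\<^sub>R y + (1 - c) *\<^sub>R p) C / c \<le> infdist y C"
    by (simp add: infdist_notempty cINF_greatest)
  then show ?thesis using assms by (simp add: field_simps)
qed

section \<open>Fixed points of the maps and the final assembly\<close>

lemma hom_map_fixed_iff:
  assumes "\<rho> i \<noteq> 1"
  shows "hom_map \<rho> a i x = x \<longleftrightarrow> x = (1 / (1 - \<rho> i)) *\<^sub>R a i"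
proof -
  have "hom_map \<rho> a i x = x \<longleftrightarrow> a i = (1 - \<rho> i) *\<^sub>R x"
    unfolding hom_map_def by (auto simp: algebra_simps)
  also have "\<dots> \<longleftrightarrow> x = (1 / (1 - \<rho> i)) *\<^sub>R a i"
    using assms by auto
  finally show ?thesis .
qed

lemma hom_map_eq_homothety:
  assumes "hom_map \<rho> a i p = p"
  shows "hom_map \<rho> a i y = \<rho> i *\<^sub>R y + (1 - \<rho> i) *\<^sub>R p"
proof -
  have "a i = (1 - \<rho> i) *\<^sub>R p"
    using assms unfolding hom_map_def
    by (metis add_diff_cancel_left' scaleR_left_diff_distrib scaleR_one)
  then show ?thesis by (simp add: hom_map_def)
qed

theorem theorem7p1:
  fixes l n :: nat
    and \<rho> :: "nat \<Rightarrow> real"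
    and a :: "nat \<Rightarrow> real ^ 'd"
    and E F :: "(real ^ 'd) set"
  assumes "l \<ge> 1"
    and "\<And>i. i \<in> {1..l} \<Longrightarrow> 0 < \<rho> i \<and> \<rho> i < 1"
    and "is_attractor l (hom_map \<rho> a) E"
    and "F = fixed_points l (hom_map \<rho> a)"
    and "real n \<ge> 1 + real l / Min (\<rho> ` {1..l})"
  shows "nfold_sum n E = (\<lambda>x. real n *\<^sub>R x) ` (convex hull F)"
proof -
  let ?m = "Min (\<rho> ` {1..l})" and ?q = "Max (\<rho> ` {1..l})"
  let ?p = "\<lambda>i. (1 / (1 - \<rho> i)) *\<^sub>R a i"
  have E: "E \<noteq> {}" "compact E" "E = (\<Union>i\<in>{1..l}. hom_map \<rho> a i ` E)"
    using assms(3) unfolding is_attractor_def by blast+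
  have fixed: "hom_map \<rho> a i x = x \<longleftrightarrow> x = ?p i" if "i \<in> {1..l}" for i x
    using assms(2)[OF that] by (intro hom_map_fixed_iff) auto
  then have F: "F = ?p ` {1..l}"
    unfolding assms(4) fixed_points_def by blast
  have p: "hom_map \<rho> a i y = \<rho> i *\<^sub>R y + (1 - \<rho> i) *\<^sub>R ?p i" if "i \<in> {1..l}" for i y
    using fixed[OF that] by (intro hom_map_eq_homothety) blast
  have finF: "finite F" "F \<noteq> {}" "card F \<le> l"
    using assms(1) card_image_le[of "{1..l}" ?p] unfolding F by auto
  have ne: "finite (\<rho> ` {1..l})" "\<rho> ` {1..l} \<noteq> {}" using assms(1) by auto
  have m: "0 < ?m" and q: "?q < 1"
    unfolding Min_gr_iff[OF ne] Max_less_iff[OF ne] using assms(2) by auto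
  have "0 \<le> real l / ?m" using m by simp
  then have "1 \<le> real n" using assms(5) by linarith
  then have n: "n \<ge> 1" by linarith
  have "real l / ?m \<le> real n - 1" using assms(5) by linarith
  then have "real l \<le> (real n - 1) * ?m" using m by (simp only: pos_divide_le_eq)
  then have card: "real (card F) \<le> (real n - 1) * ?m" using finF(3) by linarith
  \<comment> \<open>Several maps may share a fixed point. One ratio is chosen per point of
    \<open>F\<close>, and \<open>card F \<le> l\<close> keeps the bound on \<open>n\<close>
    sufficient.\<close>
  have "\<exists>c. ?m \<le> c \<and> c \<le> ?q \<and> (\<forall>y\<in>E. c *\<^sub>R y + (1 - c) *\<^sub>R f \<in> E)" if f: "f \<in> F" for f
  proof -
    obtain i where i: "i \<in> {1..l}" "f = ?p i" using f unfolding F by blast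
    have "\<rho> i *\<^sub>R y + (1 - \<rho> i) *\<^sub>R f \<in> E" if "y \<in> E" for y
    proof -
      have "hom_map \<rho> a i y \<in> E" using E(3) i(1) that by blast
      then show ?thesis unfolding p[OF i(1)] i(2) .
    qed
    moreover have "?m \<le> \<rho> i" "\<rho> i \<le> ?q" using ne i by (auto intro: Min_le Max_ge)
    ultimately show ?thesis by blast
  qed
  then obtain c where c: "\<And>f. f \<in> F \<Longrightarrow> ?m \<le> c f \<and> c f \<le> ?q \<and> (\<forall>y\<in>E. c f *\<^sub>R y + (1 - c f) *\<^sub>R f \<in> E)"
    by metis
  have C: "closed (convex hull F)" "convex hull F \<noteq> {}"
    using finF by (auto intro: compact_imp_closed finite_imp_compact_convex_hull)
  have "\<exists>y\<in>E. \<exists>c<1. infdist x (convex hull F) \<le> c * infdist y (convex hull F)" if x: "x \<in> E" for x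
  proof -
    \<comment> \<open>A preimage of \<open>x\<close> under one of the maps is farther from the hull
      by a factor of at least \<open>1 / \<rho> i\<close>.\<close>
    obtain i y where iy: "i \<in> {1..l}" "y \<in> E" "x = hom_map \<rho> a i y" using x E(3) by blast
    have "?p i \<in> convex hull F" using iy(1) F by (intro hull_inc) blast
    then have "infdist x (convex hull F) \<le> \<rho> i * infdist y (convex hull F)"
      unfolding iy(3) p[OF iy(1)]
      using C assms(2)[OF iy(1)] by (intro infdist_convex_homothety) auto
    then show ?thesis using iy(1,2) assms(2) by blast
  qed
  then have "E \<subseteq> convex hull F"
    using E C by (intro compact_subset_closed_of_contraction) auto
  then have "nfold_sum n E \<subseteq> (\<lambda>x. real n *\<^sub>R x) ` (convex hull F)"
    using n by (intro nfold_sum_subset_convex convex_convex_hull)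
  moreover have "(\<lambda>x. real n *\<^sub>R x) ` (convex hull F) \<subseteq> nfold_sum n E"
    using scaled_convex_hull_subset_nfold_sum[OF E(2,1) finF(1,2) n card m c q] .
  ultimately show ?thesis by blast
qed

end
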